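(* For every name $Q$: if $\eta\,Q\,\mathrm{Solid}$, then $\mathrm{InteriorG}(\mathrm{InteriorG}(Q))\equiv\mathrm{InteriorG}(Q)$.
   Context: Logic is classical. Names form a type $N$; a name may designate zero, one or several objects. The relation $\eta : N\to N\to \mathrm{Prop}$ (singular inclusion) is governed by Leśniewski's Ontology: $\eta\,A\,b$ holds iff [there is $C$ with $\eta\,C\,A$] and [for all $C,D$, $\eta\,C\,A$ and $\eta\,D\,A$ imply $\eta\,C\,D$] and [for all $C$, $\eta\,C\,A$ implies $\eta\,C\,b$]; i.e. $A$ designates exactly one object, which is among those designated by $b$. $A$ is an Individual iff $\eta\,A\,A$. Notation: $P\equiv Q$ iff $\eta\,P\,Q$ and $\eta\,Q\,P$; $a\approx b$ iff $\forall P,\ \eta\,P\,a\leftrightarrow\eta\,P\,b$; $a\subseteq b$ iff $\forall P,\ \eta\,P\,a\to\eta\,P\,b$. Names with the same extension are interchangeable. Name-forming operators are introduced by stating when $\eta\,P\,(\cdot)$ holds. Mereology: $\eta\,P\,(\mathrm{pt}(Q))$ ("$P$ is a part of $Q$") relates individuals and is reflexive on individuals, transitive, and antisymmetric up to $\equiv$; $\eta\,P\,(\mathrm{ppt}(Q))$ (proper part) means $\eta\,P\,(\mathrm{pt}(Q))$ and not $P\equiv Q$; $\eta\,P\,(\mathrm{ext}(Q))$ means $P,Q$ are individuals with no common part. $\eta\,A\,(\mathrm{klass}(a))$ iff $A$ is an Individual, every $B$ with $\eta\,B\,a$ satisfies $\eta\,B\,(\mathrm{pt}(A))$, and for every $B$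 with $\eta\,B\,(\mathrm{pt}(A))$ there exist $C,D$ with $\eta\,C\,a$, $\eta\,D\,(\mathrm{pt}(C))$, $\eta\,D\,(\mathrm{pt}(B))$. If some $C$ satisfies $\eta\,C\,a$, then there is $A$ with $\eta\,A\,(\mathrm{klass}(a))$, unique up to $\equiv$. Geometry: $\mathrm{balls}$ is a primitive name whose members are individuals (balls); at least one ball exists. $\eta\,P\,(\mathrm{Concent}(Q))$ means that the balls $P,Q$ are concentric in Tarski's sense: $P\equiv Q$; or $P$ is a proper part of $Q$ and any two balls $X,Y$ externally diametrical to $P$ and internally tangent to $Q$ are internally diametrical to $Q$; or the same with $P,Q$ exchanged. Here (all variables balls): $A$ is externally tangent to $B$ if $A$ is external to $B$ and of any two balls $X,Y$ having $A$ as part and external to $B$ one is part of the other; $A$ is internally tangent to $B$ if $A$ is a proper part of $B$ and of any two balls $X,Y$ having $A$ as part and being parts of $B$ one is part of the other; $A,B$ are externally diametrical to $C$ if both are externally tangent to $C$ and whenever $X,Y$ are external to $C$, $A$ is part of $X$ and $B$ is part of $Y$, then $X$ is external to $Y$; $A,B$ are internally diametrical to $C$ if both are internally tangent to $C$ and whenever $X,Y$ are external to $C$, $A$ is externally tangent to $X$ and $B$ to $Y$, then $X$ is external to $Y$. $\eta\,P\,(\mathrm{Point}(Q))$ iff $\eta\,P\,\mathrm{balls}$, $\eta\,Q\,\mathrm{balls}$ and $\eta\,P\,(\mathrm{Concent}(Q))$. Standing assumptions: concentricity is an equivalence relation on balls, and concentric balls $P,Q$ satisfy $\mathrm{Point}(P)\approx\mathrm{Point}(Q)$.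 $\eta\,P\,\mathrm{Solid}$ iff $P$ is an Individual and there is $b\subseteq\mathrm{balls}$ with $\eta\,P\,(\mathrm{klass}(b))$; parts of solids are assumed to be solids. $\eta\,P\,(\mathrm{sat\_InteriorPoint}(Q))$ iff $\eta\,Q\,\mathrm{Solid}$ and there is $P'$ with $\eta\,P\,(\mathrm{Point}(P'))$, $\eta\,P'\,(\mathrm{pt}(Q))$, and ($\eta\,P'\,(\mathrm{pt}(P))\to P\equiv P'$). $\eta\,P\,(\mathrm{InteriorG}(Q))$ iff $\eta\,P\,(\mathrm{klass}(\mathrm{sat\_InteriorPoint}(Q)))$. *)

theory Defs
  imports Main
begin

text \<open>
  Operators forming names are locale parameters of type \<open>'n \<Rightarrow> 'n\<close>, each governed by an
  equivalence stating when \<open>\<eta> P (f Q)\<close> holds; this is how definitions of names are made in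
  Ontology, where a name is given only through its extension.
\<close>

locale ontology =
  fixes \<eta> :: "'n \<Rightarrow> 'n \<Rightarrow> bool"
  assumes singular_inclusion:
    "\<eta> A b \<longleftrightarrow>
      (\<exists>C. \<eta> C A) \<and>
      (\<forall>C D. \<eta> C A \<and> \<eta> D A \<longrightarrow> \<eta> C D) \<and>
      (\<forall>C. \<eta> C A \<longrightarrow> \<eta> C b)"
begin

definition individual :: "'n \<Rightarrow> bool"
  where "individual A \<longleftrightarrow> \<eta> A A"

definition same_object :: "'n \<Rightarrow> 'n \<Rightarrow> bool"  (infix "\<equiv>\<^sub>\<eta>" 50)
  where "P \<equiv>\<^sub>\<eta> Q \<longleftrightarrow> \<eta> P Q \<and> \<eta> Q P"

definition same_extension :: "'n \<Rightarrow> 'n \<Rightarrow> bool"  (infix "\<approx>\<^sub>\<eta>" 50)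
  where "a \<approx>\<^sub>\<eta> b \<longleftrightarrow> (\<forall>P. \<eta> P a \<longleftrightarrow> \<eta> P b)"

definition weak_inclusion :: "'n \<Rightarrow> 'n \<Rightarrow> bool"  (infix "\<subseteq>\<^sub>\<eta>" 50)
  where "a \<subseteq>\<^sub>\<eta> b \<longleftrightarrow> (\<forall>P. \<eta> P a \<longrightarrow> \<eta> P b)"

end

text \<open>Interchangeability of names with the same extension, in all contexts, is rendered as equality.\<close>

locale extensional_ontology = ontology +
  assumes extensionality: "a \<approx>\<^sub>\<eta> b \<Longrightarrow> a = b"

locale mereology = extensional_ontology \<eta>
  for \<eta> :: "'n \<Rightarrow> 'n \<Rightarrow> bool" +
  fixes pt ppt ext klass :: "'n \<Rightarrow> 'n"
  assumes pt_individuals: "\<eta> P (pt Q) \<Longrightarrow> individual P \<and> individual Q"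
    and pt_refl: "individual P \<Longrightarrow> \<eta> P (pt P)"
    and pt_trans: "\<eta> P (pt Q) \<Longrightarrow> \<eta> Q (pt R) \<Longrightarrow> \<eta> P (pt R)"
    and pt_antisym: "\<eta> P (pt Q) \<Longrightarrow> \<eta> Q (pt P) \<Longrightarrow> P \<equiv>\<^sub>\<eta> Q"
    and ppt_iff: "\<eta> P (ppt Q) \<longleftrightarrow> \<eta> P (pt Q) \<and> \<not> P \<equiv>\<^sub>\<eta> Q"
    and ext_iff: "\<eta> P (ext Q) \<longleftrightarrow>
      individual P \<and> individual Q \<and> \<not> (\<exists>R. \<eta> R (pt P) \<and> \<eta> R (pt Q))"
    and klass_iff: "\<eta> A (klass a) \<longleftrightarrow>
      individual A \<and>
      (\<forall>B. \<eta> B a \<longrightarrow> \<eta> B (pt A)) \<and>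
      (\<forall>B. \<eta> B (pt A) \<longrightarrow> (\<exists>C D. \<eta> C a \<and> \<eta> D (pt C) \<and> \<eta> D (pt B)))"
    and klass_exists: "\<eta> C a \<Longrightarrow> \<exists>A. \<eta> A (klass a)"
    and klass_unique: "\<eta> C a \<Longrightarrow> \<eta> A (klass a) \<Longrightarrow> \<eta> B (klass a) \<Longrightarrow> A \<equiv>\<^sub>\<eta> B"

locale mereology_with_balls = mereology \<eta> pt ppt ext klass
  for \<eta> :: "'n \<Rightarrow> 'n \<Rightarrow> bool" and pt ppt ext klass :: "'n \<Rightarrow> 'n" +
  fixes balls :: "'n"
  assumes balls_individuals: "\<eta> P balls \<Longrightarrow> individual P"
    and ball_exists: "\<exists>P. \<eta> P balls"
begin

definition externally_tangent :: "'n \<Rightarrow> 'n \<Rightarrow> bool"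
  where "externally_tangent A B \<longleftrightarrow>
    \<eta> A balls \<and> \<eta> B balls \<and> \<eta> A (ext B) \<and>
    (\<forall>X Y. \<eta> X balls \<and> \<eta> Y balls \<and>
       \<eta> A (pt X) \<and> \<eta> A (pt Y) \<and> \<eta> X (ext B) \<and> \<eta> Y (ext B) \<longrightarrow>
       \<eta> X (pt Y) \<or> \<eta> Y (pt X))"

definition internally_tangent :: "'n \<Rightarrow> 'n \<Rightarrow> bool"
  where "internally_tangent A B \<longleftrightarrow>
    \<eta> A balls \<and> \<eta> B balls \<and> \<eta> A (ppt B) \<and>
    (\<forall>X Y. \<eta> X balls \<and> \<eta> Y balls \<and>
       \<eta> A (pt X) \<and> \<eta> A (pt Y) \<and> \<eta> X (pt B) \<and> \<eta> Y (pt B) \<longrightarrow>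
       \<eta> X (pt Y) \<or> \<eta> Y (pt X))"

definition externally_diametrical :: "'n \<Rightarrow> 'n \<Rightarrow> 'n \<Rightarrow> bool"
  where "externally_diametrical A B C \<longleftrightarrow>
    externally_tangent A C \<and> externally_tangent B C \<and>
    (\<forall>X Y. \<eta> X balls \<and> \<eta> Y balls \<and> \<eta> X (ext C) \<and> \<eta> Y (ext C) \<and>
       \<eta> A (pt X) \<and> \<eta> B (pt Y) \<longrightarrow> \<eta> X (ext Y))"

definition internally_diametrical :: "'n \<Rightarrow> 'n \<Rightarrow> 'n \<Rightarrow> bool"
  where "internally_diametrical A B C \<longleftrightarrow>
    internally_tangent A C \<and> internally_tangent B C \<and>
    (\<forall>X Y. \<eta> X balls \<and> \<eta> Y balls \<and> \<eta> X (ext C) \<and> \<eta> Y (ext C) \<and>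
       externally_tangent A X \<and> externally_tangent B Y \<longrightarrow> \<eta> X (ext Y))"

definition concentric_inside :: "'n \<Rightarrow> 'n \<Rightarrow> bool"
  where "concentric_inside P Q \<longleftrightarrow>
    \<eta> P (ppt Q) \<and>
    (\<forall>X Y. \<eta> X balls \<and> \<eta> Y balls \<and> externally_diametrical X Y P \<and>
       internally_tangent X Q \<and> internally_tangent Y Q \<longrightarrow>
       internally_diametrical X Y Q)"

end

locale geometry_of_solids = mereology_with_balls \<eta> pt ppt ext klass balls
  for \<eta> :: "'n \<Rightarrow> 'n \<Rightarrow> bool" and pt ppt ext klass :: "'n \<Rightarrow> 'n" and balls :: "'n" +
  fixes Concent Point :: "'n \<Rightarrow> 'n"
    and Solid :: "'n"
    and sat_InteriorPoint InteriorG :: "'n \<Rightarrow> 'n"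
  assumes Concent_iff: "\<eta> P (Concent Q) \<longleftrightarrow>
      \<eta> P balls \<and> \<eta> Q balls \<and>
      (P \<equiv>\<^sub>\<eta> Q \<or> concentric_inside P Q \<or> concentric_inside Q P)"
    and Point_iff: "\<eta> P (Point Q) \<longleftrightarrow> \<eta> P balls \<and> \<eta> Q balls \<and> \<eta> P (Concent Q)"
    and Concent_equiv: "equiv {P. \<eta> P balls} {(P, Q). \<eta> P (Concent Q)}"
    and Concent_Point: "\<eta> P (Concent Q) \<Longrightarrow> Point P \<approx>\<^sub>\<eta> Point Q"
    and Solid_iff: "\<eta> P Solid \<longleftrightarrow> individual P \<and> (\<exists>b. b \<subseteq>\<^sub>\<eta> balls \<and> \<eta> P (klass b))"
    and pt_Solid: "\<eta> P (pt Q) \<Longrightarrow> \<eta> Q Solid \<Longrightarrow> \<eta> P Solid"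
    and sat_InteriorPoint_iff: "\<eta> P (sat_InteriorPoint Q) \<longleftrightarrow>
      \<eta> Q Solid \<and>
      (\<exists>P'. \<eta> P (Point P') \<and> \<eta> P' (pt Q) \<and> (\<eta> P' (pt P) \<longrightarrow> P \<equiv>\<^sub>\<eta> P'))"
    and InteriorG_iff: "\<eta> P (InteriorG Q) \<longleftrightarrow> \<eta> P (klass (sat_InteriorPoint Q))"

end

theory Submission
  imports Defs
begin

text \<open>
  A solid is its own interior, so forming the interior twice is the same as forming it once.

  The clause \<open>\<eta> P' (pt P) \<longrightarrow> P \<equiv>\<^sub>\<eta> P'\<close> in the definition of an interior point forbids \<open>P'\<close> to be
  a proper part of \<open>P\<close>. Two concentric balls are always comparable as to part, so what
  remains is \<open>P\<close> part of \<open>P'\<close> part of \<open>Q\<close>; conversely, a ball that is part of \<open>Q\<close> can serve as its own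
  \<open>P'\<close>. Hence the interior points of a solid are exactly the balls contained in it
  (\<open>sat_InteriorPoint_iff_ball_part\<close>). A solid is the class of some balls, and it
  remains their class when all other balls contained in it are added (\<open>klass_enlarge\<close>); so it is
  the class of its interior points. By extensionality \<open>InteriorG Q\<close> and \<open>Q\<close> are then
  one and the same name (\<open>InteriorG_Solid\<close>).
\<close>

context ontology
begin

lemma singular_trans: "\<eta> A B \<Longrightarrow> \<eta> B c \<Longrightarrow> \<eta> A c"
  using singular_inclusion[of B c] by blast

lemma singular_sym:
  assumes "\<eta> A B" and "individual B"
  shows "\<eta> B A"
  using assms singular_inclusion[of B B] unfolding individual_def by blast

lemma same_object_refl: "individual A \<Longrightarrow> A \<equiv>\<^sub>\<eta> A"
  by (simp add: same_object_def individual_def)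

end

context mereology
begin

lemma same_object_imp_pt:
  assumes "P \<equiv>\<^sub>\<eta> Q"
  shows "\<eta> P (pt Q)"
proof -
  have PQ: "\<eta> P Q" and QP: "\<eta> Q P"
    using assms by (simp_all add: same_object_def)
  have "individual Q"
    using singular_trans[OF QP PQ] by (simp add: individual_def)
  then show ?thesis
    using pt_refl PQ singular_trans by blast
qed

text \<open>
  A class covers its parts: each of them overlaps a member of the generating name. Enlarging
  that name by further parts of the class cannot destroy this covering.
\<close>

lemma klass_enlarge:
  assumes Q: "\<eta> Q (klass b)"
    and sub: "b \<subseteq>\<^sub>\<eta> c"
    and parts: "c \<subseteq>\<^sub>\<eta> pt Q"
  shows "\<eta> Q (klass c)"
  using assms unfolding klass_iff weak_inclusion_def by blast

text \<open>
  Since a class is unique up to \<open>\<equiv>\<^sub>\<eta>\<close> and an individual name designates just one object, extensionality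
  turns membership in a class name into equality of names.
\<close>

lemma klass_eq_individual:
  assumes Q: "\<eta> Q (klass a)"
  shows "klass a = Q"
proof (rule extensionality)
  have ind: "individual Q"
    using Q by (simp add: klass_iff)
  \<comment> \<open>Only classes of inhabited names are unique; the part \<open>Q\<close> of \<open>Q\<close> overlaps a member.\<close>
  obtain C where C: "\<eta> C a"
    using Q pt_refl[OF ind] unfolding klass_iff by blast
  show "klass a \<approx>\<^sub>\<eta> Q"
    unfolding same_extension_def
  proof (intro allI iffI)
    fix P
    assume "\<eta> P (klass a)"
    then show "\<eta> P Q"
      using klass_unique[OF C _ Q] by (simp add: same_object_def)
  next
    fix P
    assume "\<eta> P Q"
    then show "\<eta> P (klass a)"
      using Q singular_trans by blast
  qed
qed

end

context geometry_of_solids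
begin

lemma Concent_comparable:
  assumes "\<eta> P (Concent Q)"
  shows "\<eta> P (pt Q) \<or> \<eta> Q (pt P)"
  using assms same_object_imp_pt
  unfolding Concent_iff concentric_inside_def ppt_iff by blast

lemma Point_refl:
  assumes "\<eta> P balls"
  shows "\<eta> P (Point P)"
  using assms same_object_refl[OF balls_individuals[OF assms]]
  by (simp add: Point_iff Concent_iff)

text \<open>
  The witness \<open>P'\<close> is comparable with \<open>P\<close> and must not be a proper part of it, so \<open>P\<close> is part of \<open>P'\<close>;
  in the other direction \<open>P\<close> is its own witness.
\<close>

lemma sat_InteriorPoint_iff_ball_part:
  assumes Q: "\<eta> Q Solid"
  shows "\<eta> P (sat_InteriorPoint Q) \<longleftrightarrow> \<eta> P balls \<and> \<eta> P (pt Q)"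
proof
  assume "\<eta> P (sat_InteriorPoint Q)"
  then obtain P' where Point: "\<eta> P (Point P')" and P'Q: "\<eta> P' (pt Q)"
    and not_inside: "\<eta> P' (pt P) \<longrightarrow> P \<equiv>\<^sub>\<eta> P'"
    unfolding sat_InteriorPoint_iff by blast
  have "\<eta> P (pt P')"
    using Point Concent_comparable[of P P'] not_inside same_object_imp_pt
    unfolding Point_iff by blast
  then show "\<eta> P balls \<and> \<eta> P (pt Q)"
    using Point P'Q pt_trans unfolding Point_iff by blast
next
  assume P: "\<eta> P balls \<and> \<eta> P (pt Q)"
  have "P \<equiv>\<^sub>\<eta> P"
    using P balls_individuals same_object_refl by blast
  then show "\<eta> P (sat_InteriorPoint Q)"
    using P Q Point_refl unfolding sat_InteriorPoint_iff by blast
qed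

lemma Solid_klass_sat_InteriorPoint:
  assumes Q: "\<eta> Q Solid"
  shows "\<eta> Q (klass (sat_InteriorPoint Q))"
proof -
  obtain b where b: "b \<subseteq>\<^sub>\<eta> balls" and Qb: "\<eta> Q (klass b)"
    using Q unfolding Solid_iff by blast
  have "b \<subseteq>\<^sub>\<eta> sat_InteriorPoint Q"
    using b Qb unfolding weak_inclusion_def klass_iff sat_InteriorPoint_iff_ball_part[OF Q]
    by blast
  moreover have "sat_InteriorPoint Q \<subseteq>\<^sub>\<eta> pt Q"
    unfolding weak_inclusion_def sat_InteriorPoint_iff_ball_part[OF Q] by blast
  ultimately show ?thesis
    using klass_enlarge[OF Qb] by blast
qed

lemma InteriorG_Solid:
  assumes "\<eta> Q Solid"
  shows "InteriorG Q = Q"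
proof -
  have "InteriorG Q = klass (sat_InteriorPoint Q)"
    by (rule extensionality) (simp add: same_extension_def InteriorG_iff)
  then show ?thesis
    using klass_eq_individual[OF Solid_klass_sat_InteriorPoint[OF assms]] by simp
qed

end

theorem theorem14:
  fixes \<eta> :: "'n \<Rightarrow> 'n \<Rightarrow> bool"
    and pt ppt ext klass :: "'n \<Rightarrow> 'n"
    and balls :: "'n"
    and Concent Point :: "'n \<Rightarrow> 'n"
    and Solid :: "'n"
    and sat_InteriorPoint InteriorG :: "'n \<Rightarrow> 'n"
    and Q :: "'n"
  assumes "geometry_of_solids \<eta> pt ppt ext klass balls Concent Point Solid
             sat_InteriorPoint InteriorG"
    and "\<eta> Q Solid"
  shows "ontology.same_object \<eta> (InteriorG (InteriorG Q)) (InteriorG Q)"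
proof -
  interpret geometry_of_solids \<eta> pt ppt ext klass balls Concent Point Solid
    sat_InteriorPoint InteriorG
    by (fact assms(1))
  have "individual Q"
    using assms(2) by (simp add: Solid_iff)
  then show ?thesis
    by (simp add: InteriorG_Solid[OF assms(2)] same_object_refl)
qed

end
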